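(* For all integers $p\ge 1$ and $q\ge 2$ there is a real constant $C_{p,q}$ (depending only on $p,q$) such that, for every fixed integer $m\ge 1$, as $n\to\infty$, $$\sum_{k=2}^{n-1} \frac{1}{k^q\, (\log k)^p} =C_{p,q}+\frac{(1-q)^{p-1}}{(p-1)!}\, \mathrm{Ei}\big((1-q)\log n\big) -\frac{1}{n^{q-1}}\sum_{r=1}^{p-1} \frac{c_{p,q,r}}{(\log n)^r} -\frac{1}{2}\frac{1}{n^q (\log n)^p} -\sum_{k=1}^m \Big(\sum_{r=0}^{2k-1} \frac{d_{p,q,r,k}}{(\log n)^{r+p}} \Big) \frac{1}{n^{2k-1+q}} +O\Big(\frac{1}{n^{2m+q}}\Big),$$ where $c_{p,q,r}:= \dfrac{(1-q)^{p-1-r} (r-1)!}{(p-1)!}$ and $d_{p,q,r,k} := \dfrac{B_{2k}\, (2k+q-2)!}{(2k)!\,(q-1)!}\, \dfrac{(p-1+r)!}{(p-1)!}\, S_{r,q,2k+q-2}$.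
   Context: $B_{2k}$ are the Bernoulli numbers. $\mathrm{Ei}(x)=-\int_{-x}^\infty\frac{e^{-t}}{t}\,dt$ (principal value) is the exponential integral. $S_{r,s,t}:=\sum_{s\le i_1<\dots<i_r\le t}\frac{1}{i_1\cdots i_r}$ (sum over integers), which is $0$ for $r\ge 1$ and $t<r+s-1$; $S_{0,s,t}:=1$ if $t\ge s-1$, and $S_{r,s,t}:=0$ if $r<0$. Empty sums are $0$. *)

theory Defs
  imports "HOL-Analysis.Analysis" "HOL-Library.Landau_Symbols"
begin

text \<open>Exponential generating function: \<open>z / (e^z - 1) = (\<Sum>n. bernoulli n * z^n / n!)\<close>.\<close>
definition bernoulli :: "nat \<Rightarrow> real" where
  "bernoulli n = fact n * fps_nth (fps_X / (fps_exp 1 - 1)) n"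

text \<open>The integral is a Cauchy principal value at \<open>t = 0\<close>. For \<open>x < 0\<close> the singularity lies outside
  the range of integration and the expression under the limit is eventually constant.\<close>
definition Ei :: "real \<Rightarrow> real" where
  "Ei x = - Lim (at_right 0)
     (\<lambda>\<epsilon>. integral {t. - x \<le> t \<and> \<epsilon> \<le> \<bar>t\<bar>} (\<lambda>t. exp (- t) / t))"

text \<open>A strictly increasing tuple \<open>s \<le> i\<^sub>1 < \<dots> < i\<^sub>r \<le> t\<close> is encoded as the \<open>r\<close>-element set of its
  entries; the empty set gives the value \<open>1\<close> for \<open>r = 0\<close>.\<close>
definition recip_sum :: "nat \<Rightarrow> nat \<Rightarrow> nat \<Rightarrow> real" where
  "recip_sum r s t = (\<Sum>A | A \<subseteq> {s..t} \<and> card A = r. 1 / (\<Prod>i\<in>A. real i))"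

definition coeff_c :: "nat \<Rightarrow> nat \<Rightarrow> nat \<Rightarrow> real" where
  "coeff_c p q r = (1 - real q) ^ (p - 1 - r) * fact (r - 1) / fact (p - 1)"

definition coeff_d :: "nat \<Rightarrow> nat \<Rightarrow> nat \<Rightarrow> nat \<Rightarrow> real" where
  "coeff_d p q r k =
     (bernoulli (2 * k) * fact (2 * k + q - 2)) / (fact (2 * k) * fact (q - 1))
     * (fact (p - 1 + r) / fact (p - 1)) * recip_sum r q (2 * k + q - 2)"

end

theory Submission
  imports Defs
begin

text \<open>The expansion is the Euler--Maclaurin formula for \<open>f x = 1 / (x^q * (ln x)^p)\<close>. Let \<open>g 0\<close>
  be a primitive of \<open>f\<close>, let \<open>g (Suc j)\<close> be the \<open>j\<close>-th derivative of \<open>f\<close>, and let \<open>b i = B_i / i!\<close>,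
  so that \<open>b\<close> has the generating function \<open>z / (e^z - 1)\<close>. The shift \<open>h \<mapsto> h (n + 1) - h n\<close> is formally
  \<open>e^D - 1\<close> with \<open>D\<close> the derivative, and therefore applying it to \<open>\<Sum>i. b i * g i\<close>, which is formally
  \<open>D / (e^D - 1)\<close> applied to \<open>g 0\<close>, gives \<open>D (g 0) = f\<close>.

  Truncating at \<open>i \<le> N\<close> and expanding every \<open>g i (n + 1)\<close> by Taylor's theorem up to the derivative of
  common index \<open>N + 1\<close> makes this rigorous (\<open>euler_maclaurin_step\<close>): the error at \<open>n\<close> is bounded by
  \<open>g (N + 1)\<close> near \<open>n\<close>, that is, by a multiple of \<open>1 / n^(q + N)\<close>. Hence the difference between the sum
  of \<open>f\<close> and \<open>\<Sum>i\<le>N. b i * g i n\<close> has increments of that size, so it converges, at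
  the rate \<open>1 / n^(q + N - 1)\<close> (\<open>limit_of_small_increments\<close>). Passing from \<open>N\<close> to \<open>N + 1\<close> changes the
  difference by a null sequence, so one constant serves all \<open>N\<close> (\<open>euler_maclaurin_asymptotic\<close>). For
  \<open>N = 2 * m + 1\<close> the error is \<open>1 / n^(2 * m + q)\<close>, and the vanishing of the Bernoulli numbers
  of odd index above \<open>1\<close> leaves exactly the terms with \<open>B_0\<close>, \<open>B_1\<close> and \<open>B_{2k}\<close>, \<open>k \<le> m\<close>.

  It remains to identify the \<open>g i\<close>. The coefficients of the iterated derivatives of \<open>f\<close> in powers of
  \<open>1 / ln x\<close> satisfy a recurrence which matches the Pascal-type recurrence of the elementary symmetric
  functions \<open>recip_sum\<close> of reciprocals (\<open>recip_power_log_deriv_has_derivative\<close>). A primitive arises from repeated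
  integration by parts, which lowers the power of \<open>1 / ln x\<close> to one, where
  \<open>Ei ((1 - q) * ln x)\<close> takes over (\<open>recip_power_log_primitive_has_derivative\<close>).\<close>

section \<open>Bernoulli weights\<close>

definition bernoulli_weight :: "nat \<Rightarrow> real" where
  "bernoulli_weight i = bernoulli i / fact i"

lemma bernoulli_weight_fps_times_exp_minus_one:
  "Abs_fps bernoulli_weight * (fps_exp 1 - 1) = fps_X"
proof -
  have eq: "Abs_fps bernoulli_weight = fps_X / (fps_exp 1 - 1)"
    by (simp add: bernoulli_weight_def bernoulli_def fps_eq_iff)
  have nz: "fps_nth (fps_exp 1 - 1 :: real fps) 1 \<noteq> 0" by simp
  have "subdegree (fps_exp 1 - 1 :: real fps) = 1"
    by (rule subdegreeI) auto
  moreover have "(fps_exp 1 - 1 :: real fps) \<noteq> 0" using nz by force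
  ultimately have "(fps_exp 1 - 1 :: real fps) dvd fps_X"
    by (simp add: fps_dvd_iff)
  then show ?thesis unfolding eq by simp
qed

text \<open>This is the coefficient form of \<open>z / (e^z - 1) * (e^z - 1) = z\<close>; the term \<open>i = s\<close> is absent
  because \<open>e^z - 1\<close> has no constant term.\<close>

lemma bernoulli_weight_convolution:
  "(\<Sum>i<s. bernoulli_weight i / fact (s - i)) = (if s = 1 then 1 else 0)"
proof -
  have "(\<Sum>i<s. bernoulli_weight i / fact (s - i)) =
     (\<Sum>i=0..s. bernoulli_weight i * fps_nth (fps_exp 1 - 1) (s - i))"
    by (rule sum.mono_neutral_cong_left) (auto simp: not_less)
  also have "\<dots> = fps_nth (Abs_fps bernoulli_weight * (fps_exp 1 - 1)) s"
    by (simp add: fps_mult_nth)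
  finally show ?thesis by (simp add: bernoulli_weight_fps_times_exp_minus_one)
qed

lemma bernoulli_weight_0: "bernoulli_weight 0 = 1"
  using bernoulli_weight_convolution[of 1] by simp

lemma bernoulli_weight_1: "bernoulli_weight 1 = - 1 / 2"
  using bernoulli_weight_convolution[of 2] by (simp add: bernoulli_weight_0 numeral_2_eq_2)

text \<open>The series \<open>b(z) = z / (e^z - 1)\<close> satisfies \<open>b(-z) = b(z) + z\<close>, so that its odd part is
  \<open>- z / 2\<close>. To see this, substitute \<open>-z\<close> in \<open>b(z) * (e^z - 1) = z\<close> and multiply by \<open>e^z\<close>.\<close>

lemma bernoulli_weight_odd:
  assumes "odd i" "i \<noteq> 1"
  shows "bernoulli_weight i = 0"
proof -
  let ?b = "Abs_fps bernoulli_weight" and ?e = "fps_exp 1 :: real fps"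
  let ?c = "fps_compose ?b (- fps_X)"
  have exp_compose: "fps_compose ?e (- fps_X) = fps_exp (- 1)"
    by (simp add: fps_compose_uminus' fps_eq_iff)
  have "fps_compose (?b * (?e - 1)) (- fps_X) = - fps_X"
    by (simp add: bernoulli_weight_fps_times_exp_minus_one)
  then have "?c * (fps_exp (- 1) - 1) = - fps_X"
    by (simp add: fps_compose_mult_distrib fps_compose_sub_distrib exp_compose)
  then have "?c * ((fps_exp (- 1) - 1) * ?e) = - fps_X * ?e" by (simp only: mult.assoc[symmetric])
  moreover have "(fps_exp (- 1) - 1) * ?e = - (?e - 1)"
    using fps_exp_add_mult[of "-1::real" 1] by (simp add: left_diff_distrib)
  ultimately have "?c * (?e - 1) = fps_X * ?e"
    by (simp only: mult_minus_left mult_minus_right neg_equal_iff_equal)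
  also have "\<dots> = (?b + fps_X) * (?e - 1)"
    by (simp add: distrib_right bernoulli_weight_fps_times_exp_minus_one)
       (simp add: algebra_simps)
  finally have "?c * (?e - 1) = (?b + fps_X) * (?e - 1)" .
  moreover have "fps_nth (?e - 1) 1 \<noteq> 0" by simp
  then have "?e - 1 \<noteq> 0" by force
  ultimately have "?c = ?b + fps_X" by simp
  then have "fps_nth ?c i = fps_nth (?b + fps_X) i" by simp
  then show ?thesis using assms by (simp add: fps_compose_uminus')
qed

lemma sum_bernoulli_weight_even:
  "(\<Sum>i\<le>2*m+1. bernoulli_weight i * h i) =
     h 0 - h 1 / 2 + (\<Sum>k=1..m. bernoulli_weight (2*k) * h (2*k))"
proof (induction m)
  case 0
  show ?case using bernoulli_weight_0 bernoulli_weight_1 by simp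
next
  case (Suc m)
  have "bernoulli_weight (2 * m + 3) = 0" by (rule bernoulli_weight_odd) auto
  then have "(\<Sum>i\<le>2*Suc m+1. bernoulli_weight i * h i) =
     (\<Sum>i\<le>2*m+1. bernoulli_weight i * h i) + bernoulli_weight (2*Suc m) * h (2*Suc m)"
    by (simp add: numeral_3_eq_3)
  then show ?case unfolding Suc by simp
qed

section \<open>Euler--Maclaurin summation\<close>

text \<open>All Taylor expansions at \<open>x\<close> are cut off at the same derivative \<open>g (Suc N)\<close>, so the expansion of
  \<open>g i\<close> has \<open>N - i\<close> terms beyond \<open>g i x\<close>. Collecting the factor of \<open>g s x\<close> then gives the full
  convolution sum of \<open>bernoulli_weight_convolution\<close> for every \<open>s \<le> N\<close>, which leaves \<open>g 1 x\<close> alone.\<close>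

lemma euler_maclaurin_step:
  fixes g :: "nat \<Rightarrow> real \<Rightarrow> real"
  assumes deriv: "\<And>i t. i \<le> N \<Longrightarrow> x \<le> t \<Longrightarrow> t \<le> x + 1 \<Longrightarrow>
      (g i has_real_derivative g (Suc i) t) (at t)"
    and bound: "\<And>t. x \<le> t \<Longrightarrow> t \<le> x + 1 \<Longrightarrow> \<bar>g (Suc N) t\<bar> \<le> B"
    and N: "N \<ge> 1"
  shows "\<bar>(\<Sum>i\<le>N. bernoulli_weight i * (g i (x + 1) - g i x)) - g 1 x\<bar>
      \<le> (\<Sum>i\<le>N. \<bar>bernoulli_weight i\<bar>) * B"
proof -
  have rem: "\<bar>g i (x + 1) - g i x - (\<Sum>s\<in>{i<..N}. g s x / fact (s - i))\<bar> \<le> B"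
    if i: "i \<le> N" for i
  proof -
    have "\<exists>t. x < t \<and> t < x + 1 \<and> g i (x + 1) =
       (\<Sum>m<Suc N - i. g (i + m) x / fact m * (x + 1 - x) ^ m) +
         g (i + (Suc N - i)) t / fact (Suc N - i) * (x + 1 - x) ^ (Suc N - i)"
      by (rule Taylor_up[where a = x and diff = "\<lambda>m. g (i + m)"]) (use i deriv in auto)
    then obtain t where t: "x < t" "t < x + 1" and
      "g i (x + 1) = (\<Sum>m<Suc N - i. g (i + m) x / fact m) + g (Suc N) t / fact (Suc N - i)"
      using i by auto
    moreover have "(\<Sum>m<Suc N - i. g (i + m) x / fact m) = (\<Sum>s\<in>{i..N}. g s x / fact (s - i))"
      by (rule sum.reindex_bij_witness[of _ "\<lambda>s. s - i" "\<lambda>m. i + m"]) auto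
    moreover have "(\<Sum>s\<in>{i..N}. g s x / fact (s - i)) = g i x + (\<Sum>s\<in>{i<..N}. g s x / fact (s - i))"
      using i by (simp add: sum.head)
    ultimately have eq: "g i (x + 1) - g i x - (\<Sum>s\<in>{i<..N}. g s x / fact (s - i)) =
       g (Suc N) t / fact (Suc N - i)" by simp
    have "\<bar>g (Suc N) t / fact (Suc N - i)\<bar> \<le> \<bar>g (Suc N) t\<bar> / 1"
      unfolding abs_divide by (rule divide_left_mono) auto
    then show ?thesis unfolding eq using bound[of t] t by simp
  qed
  \<comment> \<open>The Taylor polynomials are summed by the index \<open>s\<close> of the derivative.\<close>
  have "(\<Sum>i\<le>N. bernoulli_weight i * (\<Sum>s\<in>{i<..N}. g s x / fact (s - i))) =
     (\<Sum>i\<le>N. \<Sum>s\<in>{i<..N}. g s x * (bernoulli_weight i / fact (s - i)))"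
    by (simp add: sum_distrib_left mult_ac)
  also have "\<dots> = (\<Sum>s\<le>N. \<Sum>i<s. g s x * (bernoulli_weight i / fact (s - i)))"
    unfolding sum.Sigma[OF finite_atMost, simplified]
    by (subst (1 2) sum.Sigma; simp?)
       (rule sum.reindex_bij_witness[of _ "\<lambda>(s,i). (i,s)" "\<lambda>(i,s). (s,i)"]; auto)
  also have "\<dots> = (\<Sum>s\<le>N. g s x * (if s = 1 then 1 else 0))"
    by (simp only: sum_distrib_left[symmetric] bernoulli_weight_convolution)
  also have "\<dots> = g 1 x"
    using N by (subst sum.cong[OF refl, where h = "\<lambda>s. if s = 1 then g s x else 0"]) auto
  finally have "(\<Sum>i\<le>N. bernoulli_weight i * (g i (x + 1) - g i x)) - g 1 x =
     (\<Sum>i\<le>N. bernoulli_weight i *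
        (g i (x + 1) - g i x - (\<Sum>s\<in>{i<..N}. g s x / fact (s - i))))"
    by (simp add: right_diff_distrib sum_subtractf)
  also have "\<bar>\<dots>\<bar> \<le> (\<Sum>i\<le>N. \<bar>bernoulli_weight i\<bar> * B)"
    by (rule order_trans[OF sum_abs], rule sum_mono)
       (use rem in \<open>auto simp: abs_mult intro!: mult_left_mono\<close>)
  finally show ?thesis by (simp add: sum_distrib_right)
qed

text \<open>A substitute for comparing \<open>\<Sum>k. 1 / k^(s+1)\<close> with an integral: it bounds each term by a
  telescoping difference. The factor \<open>2^s\<close> comes from \<open>k + 1 \<le> 2 * k\<close>.\<close>

lemma power_increment_telescope:
  fixes k :: real
  assumes "k \<ge> 1" "s \<ge> 1"
  shows "1 / k ^ Suc s \<le> 2 ^ s * (1 / k ^ s - 1 / (k + 1) ^ s)"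
proof -
  have "k ^ s + k ^ (s - 1) \<le> (k + 1) ^ s"
  proof -
    have "(k + 1) ^ s = (k + 1) * (k + 1) ^ (s - 1)"
      using assms by (simp add: power_eq_if)
    also have "\<dots> \<ge> (k + 1) * k ^ (s - 1)"
      using assms by (intro mult_left_mono power_mono) auto
    finally show ?thesis using assms by (simp add: distrib_right power_eq_if)
  qed
  then have inc: "k ^ s / k \<le> (k + 1) ^ s - k ^ s" using assms by (simp add: power_eq_if)
  have "(k + 1) ^ s \<le> (2 * k) ^ s" using assms by (intro power_mono) auto
  then have "1 / k ^ Suc s \<le> 2 ^ s / (k * (k + 1) ^ s)"
    using assms by (simp add: field_simps power_mult_distrib)
  also have "\<dots> = 2 ^ s * ((k ^ s / k) / (k ^ s * (k + 1) ^ s))"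
    using assms by simp
  also have "\<dots> \<le> 2 ^ s * (((k + 1) ^ s - k ^ s) / (k ^ s * (k + 1) ^ s))"
    using assms inc by (intro mult_left_mono divide_right_mono) auto
  also have "((k + 1) ^ s - k ^ s) / (k ^ s * (k + 1) ^ s) = 1 / k ^ s - 1 / (k + 1) ^ s"
    using assms by (simp add: field_simps)
  finally show ?thesis .
qed

lemma limit_of_small_increments:
  fixes a :: "nat \<Rightarrow> real"
  assumes inc: "\<And>n. n \<ge> n0 \<Longrightarrow> \<bar>a (Suc n) - a n\<bar> \<le> K / real n ^ Suc s"
    and n0: "n0 \<ge> 1" and s: "s \<ge> 1"
  shows "\<exists>C. a \<longlonglongrightarrow> C \<and> (\<forall>n\<ge>n0. \<bar>a n - C\<bar> \<le> K * 2 ^ s / real n ^ s)"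
proof -
  have "0 \<le> \<bar>a (Suc n0) - a n0\<bar>" by simp
  also have "\<dots> \<le> K / real n0 ^ Suc s" by (rule inc) simp
  finally have "0 \<le> K / real n0 ^ Suc s * real n0 ^ Suc s" by (intro mult_nonneg_nonneg) auto
  then have K: "K \<ge> 0" using n0 by simp
  have tele: "\<bar>a m - a n\<bar> \<le> K * 2 ^ s * (1 / real n ^ s - 1 / real m ^ s)"
    if "n \<ge> n0" "m \<ge> n" for m n
    using that(2)
  proof (induction m rule: dec_induct)
    case (step k)
    have "\<bar>a (Suc k) - a k\<bar> \<le> K * (1 / real k ^ Suc s)" using inc[of k] step that by simp
    also have "\<dots> \<le> K * (2 ^ s * (1 / real k ^ s - 1 / (real k + 1) ^ s))"
      using step that n0 s K by (intro mult_left_mono power_increment_telescope) auto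
    finally show ?case using step.IH by (simp add: algebra_simps)
  qed simp
  have bd: "\<bar>a m - a n\<bar> \<le> K * 2 ^ s / real n ^ s" if "n \<ge> n0" "m \<ge> n" for m n
  proof -
    have "K * 2 ^ s * (1 / real n ^ s - 1 / real m ^ s) \<le> K * 2 ^ s * (1 / real n ^ s)"
      using K by (intro mult_left_mono) auto
    then show ?thesis using tele[OF that] by simp
  qed
  have "(\<lambda>n. (K * 2 ^ s) * inverse (real n ^ s)) \<longlonglongrightarrow> (K * 2 ^ s) * 0"
    using s by (intro tendsto_mult tendsto_const tendsto_inverse_0_at_top
        filterlim_pow_at_top filterlim_real_sequentially) auto
  then have lim0: "(\<lambda>n. K * 2 ^ s / real n ^ s) \<longlonglongrightarrow> 0" by (simp add: divide_inverse)
  have "Cauchy a"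
  proof (rule metric_CauchyI)
    fix e :: real assume "e > 0"
    then have "\<forall>\<^sub>F n in sequentially. K * 2 ^ s / real n ^ s < e / 2"
      using order_tendstoD(2)[OF lim0, of "e/2"] by simp
    then obtain n1 where n1: "\<And>n. n \<ge> n1 \<Longrightarrow> K * 2 ^ s / real n ^ s < e / 2"
      by (auto simp: eventually_sequentially)
    have "dist (a m) (a n) < e" if "m \<ge> max n0 n1" "n \<ge> max n0 n1" for m n
      using bd[OF max.cobounded1 that(1)] bd[OF max.cobounded1 that(2)] n1[OF max.cobounded2[of n1 n0]]
      unfolding dist_real_def by linarith
    then show "\<exists>M. \<forall>m\<ge>M. \<forall>n\<ge>M. dist (a m) (a n) < e" by blast
  qed
  then obtain C where C: "a \<longlonglongrightarrow> C"
    unfolding Cauchy_convergent_iff convergent_def by blast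
  have "\<bar>a n - C\<bar> \<le> K * 2 ^ s / real n ^ s" if "n \<ge> n0" for n
  proof (rule tendsto_upperbound)
    show "(\<lambda>m. \<bar>a n - a m\<bar>) \<longlonglongrightarrow> \<bar>a n - C\<bar>" by (intro tendsto_intros C)
    show "\<forall>\<^sub>F m in sequentially. \<bar>a n - a m\<bar> \<le> K * 2 ^ s / real n ^ s"
      using bd[OF that] by (auto simp: eventually_sequentially abs_minus_commute)
  qed simp
  then show ?thesis using C by blast
qed

text \<open>The sequence \<open>g 0, g 1, \<dots>\<close> starts with a primitive of the summand \<open>g 1\<close>. The constant is chosen
  before \<open>N\<close>: it is the limit for \<open>N = 1\<close>, and raising \<open>N\<close> subtracts the term
  \<open>bernoulli_weight (Suc N) * g (Suc N) n\<close>, which tends to \<open>0\<close>.\<close>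

theorem euler_maclaurin_asymptotic:
  fixes g :: "nat \<Rightarrow> real \<Rightarrow> real" and K :: "nat \<Rightarrow> real"
  assumes deriv: "\<And>i x. x \<ge> real n0 \<Longrightarrow> (g i has_real_derivative g (Suc i) x) (at x)"
    and bound: "\<And>j x. x \<ge> real n0 \<Longrightarrow> \<bar>g (Suc j) x\<bar> \<le> K j / x ^ (q + j)"
    and n0: "n0 \<ge> l" "n0 \<ge> 1" and q: "q \<ge> 1"
  shows "\<exists>C. \<forall>N\<ge>1. (\<lambda>n. (\<Sum>k=l..n-1. g 1 (real k)) - (C + (\<Sum>i\<le>N. bernoulli_weight i * g i (real n))))
            \<in> O(\<lambda>n. 1 / real n ^ (q + N - 1))"
proof -
  define a where "a = (\<lambda>N n. (\<Sum>k=l..n-1. g 1 (real k)) - (\<Sum>i\<le>N. bernoulli_weight i * g i (real n)))"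
  have K: "K j \<ge> 0" for j
  proof -
    have "0 \<le> \<bar>g (Suc j) (real n0)\<bar>" by simp
    also have "\<dots> \<le> K j / real n0 ^ (q + j)" by (rule bound) simp
    finally have "0 \<le> K j / real n0 ^ (q + j) * real n0 ^ (q + j)" by (intro mult_nonneg_nonneg) auto
    then show ?thesis using n0 by simp
  qed
  have ex: "\<exists>C B. a N \<longlonglongrightarrow> C \<and> (\<forall>n\<ge>n0. \<bar>a N n - C\<bar> \<le> B / real n ^ (q + N - 1))" if N: "N \<ge> 1" for N
  proof -
    let ?W = "(\<Sum>i\<le>N. \<bar>bernoulli_weight i\<bar>) * K N"
    have "\<bar>a N (Suc n) - a N n\<bar> \<le> ?W / real n ^ Suc (q + N - 1)" if n: "n \<ge> n0" for n
    proof -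
      have "{l..n} = insert n {l..n-1}" using n n0 by auto
      then have "(\<Sum>k=l..n. g 1 (real k)) = g 1 (real n) + (\<Sum>k=l..n-1. g 1 (real k))"
        using n n0 by (simp add: Suc_le_eq)
      then have "a N (Suc n) - a N n =
        - ((\<Sum>i\<le>N. bernoulli_weight i * (g i (real n + 1) - g i (real n))) - g 1 (real n))"
        unfolding a_def by (simp add: right_diff_distrib sum_subtractf add.commute)
      also have "\<bar>\<dots>\<bar> \<le> (\<Sum>i\<le>N. \<bar>bernoulli_weight i\<bar>) * (K N / real n ^ (q + N))"
        unfolding abs_minus_cancel
      proof (rule euler_maclaurin_step)
        fix t assume t: "real n \<le> t" "t \<le> real n + 1"
        have "\<bar>g (Suc N) t\<bar> \<le> K N / t ^ (q + N)" using t n by (intro bound) simp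
        also have "\<dots> \<le> K N / real n ^ (q + N)"
          using t n n0 K by (intro divide_left_mono power_mono mult_pos_pos) auto
        finally show "\<bar>g (Suc N) t\<bar> \<le> K N / real n ^ (q + N)" .
      qed (use N n deriv in auto)
      finally show ?thesis using q by simp
    qed
    from limit_of_small_increments[OF this n0(2)] N q show ?thesis by fastforce
  qed
  then obtain C where C1: "a 1 \<longlonglongrightarrow> C" by blast
  have C: "a N \<longlonglongrightarrow> C" if "N \<ge> 1" for N
    using that
  proof (induction N rule: dec_induct)
    case (step N)
    have "(\<lambda>n. g (Suc N) (real n)) \<longlonglongrightarrow> 0"
    proof (rule Lim_null_comparison)
      show "\<forall>\<^sub>F n in sequentially. norm (g (Suc N) (real n)) \<le> K N / real n ^ (q + N)"
        using bound by (auto simp: eventually_sequentially intro!: exI[of _ n0])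
      have "(\<lambda>n. K N * inverse (real n ^ (q + N))) \<longlonglongrightarrow> K N * 0"
        using q by (intro tendsto_mult tendsto_const tendsto_inverse_0_at_top
          filterlim_pow_at_top filterlim_real_sequentially) auto
      then show "(\<lambda>n. K N / real n ^ (q + N)) \<longlonglongrightarrow> 0" by (simp add: divide_inverse)
    qed
    then have "(\<lambda>n. a N n - bernoulli_weight (Suc N) * g (Suc N) (real n)) \<longlonglongrightarrow> C - bernoulli_weight (Suc N) * 0"
      by (intro tendsto_intros step)
    moreover have "(\<lambda>n. a N n - bernoulli_weight (Suc N) * g (Suc N) (real n)) = a (Suc N)"
      by (simp add: a_def fun_eq_iff)
    ultimately show ?case by simp
  qed (rule C1)
  have "(\<lambda>n. (\<Sum>k=l..n-1. g 1 (real k)) - (C + (\<Sum>i\<le>N. bernoulli_weight i * g i (real n))))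
            \<in> O(\<lambda>n. 1 / real n ^ (q + N - 1))" if N: "N \<ge> 1" for N
  proof -
    obtain C' B where "a N \<longlonglongrightarrow> C'" and B: "\<And>n. n \<ge> n0 \<Longrightarrow> \<bar>a N n - C'\<bar> \<le> B / real n ^ (q + N - 1)"
      using ex[OF N] by blast
    then have "C' = C" using C[OF N] LIMSEQ_unique by blast
    have "(\<lambda>n. a N n - C) \<in> O(\<lambda>n. 1 / real n ^ (q + N - 1))"
      by (rule bigoI[where c = B])
         (use B \<open>C' = C\<close> in \<open>auto simp: eventually_sequentially\<close>)
    then show ?thesis by (simp add: a_def algebra_simps)
  qed
  then show ?thesis by blast
qed

section \<open>The exponential integral on the negative axis\<close>

lemma integrable_exp_minus_over_atLeast:
  fixes y :: real
  assumes "y > 0"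
  shows "(\<lambda>t. exp (- t) / t) integrable_on {y..}"
proof (rule measurable_bounded_by_integrable_imp_integrable)
  show "(\<lambda>t. exp (- t) / t) \<in> borel_measurable (lebesgue_on {y..})"
    using assms by (intro continuous_imp_measurable_on_sets_lebesgue continuous_intros) auto
  have "(\<lambda>t::real. exp (- 1 * t)) integrable_on {y..}"
    by (rule integrable_on_exp_minus_to_infinity) simp
  then have "(\<lambda>t::real. exp (- t)) integrable_on {y..}" by simp
  from integrable_on_divide[OF this]
  show "(\<lambda>t::real. exp (- t) / y) integrable_on {y..}" .
  show "norm (exp (- t) / t) \<le> exp (- t) / y" if "t \<in> {y..}" for t
    using assms that by (auto intro!: divide_left_mono)
qed auto

lemma Ei_neg:
  assumes "x < 0"
  shows "Ei x = - integral {- x..} (\<lambda>t. exp (- t) / t)"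
proof -
  have "{t. - x \<le> t \<and> \<epsilon> \<le> \<bar>t\<bar>} = {- x..}" if "\<epsilon> < - x" for \<epsilon>
    using that assms by auto
  then have "\<forall>\<^sub>F \<epsilon> in at_right 0. integral {- x..} (\<lambda>t. exp (- t) / t) =
      integral {t. - x \<le> t \<and> \<epsilon> \<le> \<bar>t\<bar>} (\<lambda>t. exp (- t) / t)"
    using assms by (auto simp: eventually_at_right_field intro!: exI[of _ "- x"])
  then have "((\<lambda>\<epsilon>. integral {t. - x \<le> t \<and> \<epsilon> \<le> \<bar>t\<bar>} (\<lambda>t. exp (- t) / t)) \<longlongrightarrow>
      integral {- x..} (\<lambda>t. exp (- t) / t)) (at_right 0)"
    by (rule Lim_transform_eventually[OF tendsto_const])
  then show ?thesis unfolding Ei_def by (simp add: tendsto_Lim)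
qed

text \<open>The tail integral from \<open>y\<close> is a constant minus the integral over \<open>{a..y}\<close> for a base point
  \<open>a\<close> strictly between \<open>0\<close> and \<open>- x\<close>, to which the fundamental theorem of calculus applies.\<close>

lemma Ei_has_real_derivative_neg:
  assumes "x < 0"
  shows "(Ei has_real_derivative exp x / x) (at x)"
proof -
  let ?f = "\<lambda>t::real. exp (- t) / t"
  define a where "a = - x / 2"
  have a: "0 < a" "a < - x" using assms by (auto simp: a_def)
  have split: "integral {a..} ?f = integral {a..y} ?f + integral {y..} ?f" if "y > a" for y
  proof -
    have "((?f) has_integral (integral {a..y} ?f + integral {y..} ?f)) ({a..y} \<union> {y..})"
    proof (rule has_integral_Un)
      have "continuous_on {a..y} ?f" using a by (intro continuous_intros) auto
      then show "(?f has_integral integral {a..y} ?f) {a..y}"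
        by (intro integrable_integral integrable_continuous_interval)
      show "(?f has_integral integral {y..} ?f) {y..}"
        using a that by (intro integrable_integral integrable_exp_minus_over_atLeast) auto
      have "{a..y} \<inter> {y..} = {y}" using that by auto
      then show "negligible ({a..y} \<inter> {y..})" by (simp only: negligible_sing)
    qed
    moreover have "{a..y} \<union> {y..} = {a..}" using that by auto
    ultimately have "(?f has_integral (integral {a..y} ?f + integral {y..} ?f)) {a..}"
      by (simp only:)
    then show ?thesis by (rule integral_unique)
  qed
  have "((\<lambda>y. integral {a..y} ?f) has_real_derivative ?f (- x)) (at (- x) within {a..- x + 1})"
    using a by (intro integral_has_real_derivative continuous_intros) auto
  moreover have "at (- x) within {a..- x + 1} = at (- x)"
    using a by (intro at_within_interior) (simp add: interior_atLeastAtMost_real)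
  ultimately have deriv: "((\<lambda>y. integral {a..y} ?f) has_real_derivative ?f (- x)) (at (- x))"
    by (simp only:)
  have "((\<lambda>x. integral {a..- x} ?f) has_real_derivative ?f (- x) * (- 1)) (at x)"
    by (rule DERIV_chain2[where f = "\<lambda>y. integral {a..y} ?f" and g = "\<lambda>x. - x",
        OF deriv DERIV_minus[OF DERIV_ident]])
  then have "((\<lambda>x. integral {a..- x} ?f - integral {a..} ?f) has_real_derivative exp x / x) (at x)"
    by (rule DERIV_diff[OF _ DERIV_const, THEN DERIV_cong]) simp
  then show ?thesis
  proof (rule has_field_derivative_transform_within_open)
    show "open {..< - a}" by (rule open_lessThan)
    show "x \<in> {..< - a}" using a by simp
    show "integral {a..- z} ?f - integral {a..} ?f = Ei z" if "z \<in> {..< - a}" for z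
    proof -
      have z: "- z > a" "z < 0" using that a by auto
      show ?thesis unfolding Ei_neg[OF z(2)] split[OF z(1)] by linarith
    qed
  qed
qed

section \<open>Derivatives of the summand\<close>

lemma recip_sum_0: "recip_sum 0 s t = 1"
proof -
  have "{A. A \<subseteq> {s..t} \<and> card A = 0} = {{}}"
    by (auto dest: finite_subset)
  then show ?thesis by (simp add: recip_sum_def)
qed

lemma recip_sum_eq_0:
  assumes "card {s..t} < r"
  shows "recip_sum r s t = 0"
proof -
  have "{A. A \<subseteq> {s..t} \<and> card A = r} = {}"
  proof -
    have "card A < r" if "A \<subseteq> {s..t}" for A
      using card_mono[OF finite_atLeastAtMost that] assms by (rule le_less_trans)
    then show ?thesis by blast
  qed
  then show ?thesis by (simp only: recip_sum_def sum.empty)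
qed

text \<open>The index sets in \<open>{s..Suc t}\<close> are split by whether they contain \<open>Suc t\<close>.\<close>

lemma recip_sum_Suc:
  assumes "s \<le> Suc t"
  shows "recip_sum (Suc r) s (Suc t) = recip_sum (Suc r) s t + recip_sum r s t / real (Suc t)"
proof -
  let ?P = "\<lambda>A. 1 / (\<Prod>i\<in>A. real i)"
  let ?X = "{A. A \<subseteq> {s..t} \<and> card A = Suc r}" and ?Y = "{A. A \<subseteq> {s..t} \<and> card A = r}"
  have ins: "{s..Suc t} = insert (Suc t) {s..t}" using assms by auto
  have fin: "finite A" if "A \<subseteq> {s..t}" for A using that finite_subset by blast
  have split: "{A. A \<subseteq> {s..Suc t} \<and> card A = Suc r} = ?X \<union> insert (Suc t) ` ?Y"
  proof (intro equalityI subsetI)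
    fix A assume A: "A \<in> {A. A \<subseteq> {s..Suc t} \<and> card A = Suc r}"
    show "A \<in> ?X \<union> insert (Suc t) ` ?Y"
    proof (cases "Suc t \<in> A")
      case True
      then have "A = insert (Suc t) (A - {Suc t})" by auto
      moreover have "A - {Suc t} \<in> ?Y" using A True ins by (auto simp: card_Diff_singleton)
      ultimately show ?thesis by blast
    next
      case False
      then show ?thesis using A ins by auto
    qed
  next
    fix A assume "A \<in> ?X \<union> insert (Suc t) ` ?Y"
    then show "A \<in> {A. A \<subseteq> {s..Suc t} \<and> card A = Suc r}"
    proof
      assume "A \<in> insert (Suc t) ` ?Y"
      then obtain B where "A = insert (Suc t) B" "B \<subseteq> {s..t}" "card B = r" by auto
      moreover have "Suc t \<notin> B" using \<open>B \<subseteq> {s..t}\<close> by auto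
      ultimately show ?thesis using fin ins by auto
    qed (use ins in auto)
  qed
  have "recip_sum (Suc r) s (Suc t) = sum ?P ?X + sum ?P (insert (Suc t) ` ?Y)"
    unfolding recip_sum_def split
  proof (rule sum.union_disjoint)
    show "finite ?X" "finite (insert (Suc t) ` ?Y)"
      by (auto intro: finite_subset[of _ "Pow {s..t}"])
    show "?X \<inter> insert (Suc t) ` ?Y = {}" by fastforce
  qed
  also have "sum ?P (insert (Suc t) ` ?Y) = (\<Sum>A\<in>?Y. ?P (insert (Suc t) A))"
  proof (rule sum.reindex_cong[OF _ refl refl])
    show "inj_on (insert (Suc t)) ?Y"
    proof (rule inj_onI)
      fix A B assume "A \<in> ?Y" "B \<in> ?Y" and eq: "insert (Suc t) A = insert (Suc t) B"
      then have "Suc t \<notin> A" "Suc t \<notin> B" by auto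
      with eq show "A = B" by (simp add: insert_ident)
    qed
  qed
  also have "\<dots> = (\<Sum>A\<in>?Y. ?P A / real (Suc t))"
  proof (rule sum.cong[OF refl])
    fix A assume A: "A \<in> ?Y"
    then have "Suc t \<notin> A" by auto
    then show "?P (insert (Suc t) A) = ?P A / real (Suc t)" using A fin[of A] by simp
  qed
  finally show ?thesis by (simp add: recip_sum_def sum_divide_distrib)
qed

text \<open>The product of \<open>(q + j - 1)! / (q - 1)!\<close> and \<open>recip_sum r q (q + j - 1)\<close> is the
  elementary symmetric function of degree \<open>j - r\<close> in \<open>q, \<dots>, q + j - 1\<close>: the \<open>j\<close>-th
  derivative of \<open>1 / (x^q * (ln x)^p)\<close> chooses, at each of its \<open>j\<close> steps, either the power of \<open>x\<close>
  or the power of \<open>ln x\<close> to differentiate, the latter \<open>r\<close> times in total with the factors \<open>p, \<dots>, p + r - 1\<close>.\<close>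

definition recip_power_log_coeff :: "nat \<Rightarrow> nat \<Rightarrow> nat \<Rightarrow> nat \<Rightarrow> real" where
  "recip_power_log_coeff p q j r =
     fact (q + j - 1) / fact (q - 1) * (fact (p - 1 + r) / fact (p - 1)) * recip_sum r q (q + j - 1)"

lemma recip_power_log_coeff_Suc_0:
  assumes "q \<ge> 1"
  shows "recip_power_log_coeff p q (Suc j) 0 = real (q + j) * recip_power_log_coeff p q j 0"
  using assms fact_reduce[of "q + j", where 'a = real]
  by (simp add: recip_power_log_coeff_def recip_sum_0)

lemma recip_power_log_coeff_Suc_Suc:
  assumes "q \<ge> 1" "p \<ge> 1"
  shows "recip_power_log_coeff p q (Suc j) (Suc r) =
    real (q + j) * recip_power_log_coeff p q j (Suc r) + real (p + r) * recip_power_log_coeff p q j r"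
proof -
  obtain t where t: "q + j = Suc t" using assms by (cases "q + j") auto
  obtain u where u: "p = Suc u" using assms by (cases p) auto
  have "recip_sum (Suc r) q (Suc t) = recip_sum (Suc r) q t + recip_sum r q t / real (Suc t)"
    by (rule recip_sum_Suc) (use t in simp)
  then have rec: "real (Suc t) * recip_sum (Suc r) q (Suc t) =
      real (Suc t) * recip_sum (Suc r) q t + recip_sum r q t"
    by (simp add: distrib_left del: of_nat_Suc)
  have idx: "q + Suc j - 1 = Suc t" "q + j - 1 = t" "p - 1 + Suc r = Suc (u + r)" "p - 1 + r = u + r"
    using t u by auto
  have "recip_power_log_coeff p q (Suc j) (Suc r) =
     fact t / fact (q - 1) * (real (p + r) * fact (u + r) / fact (p - 1)) *
     (real (Suc t) * recip_sum (Suc r) q (Suc t))"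
    unfolding recip_power_log_coeff_def idx by (simp add: u mult_ac)
  also have "\<dots> = real (q + j) * recip_power_log_coeff p q j (Suc r)
       + real (p + r) * recip_power_log_coeff p q j r"
    unfolding rec recip_power_log_coeff_def idx t
    by (simp add: u distrib_left add_divide_distrib mult_ac del: of_nat_add of_nat_Suc)
  finally show ?thesis .
qed

definition recip_power_log_deriv :: "nat \<Rightarrow> nat \<Rightarrow> nat \<Rightarrow> real \<Rightarrow> real" where
  "recip_power_log_deriv p q j x =
     (- 1) ^ j / x ^ (q + j) * (\<Sum>r\<le>j. recip_power_log_coeff p q j r / ln x ^ (p + r))"

lemma recip_power_log_has_derivative:
  fixes x :: real
  assumes "x > 1"
  shows "((\<lambda>x. 1 / x ^ a * (1 / ln x ^ b)) has_real_derivative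
     - (1 / x ^ Suc a) * (real a / ln x ^ b + real b / ln x ^ Suc b)) (at x)"
proof -
  have ln: "ln x > 0" using assms by simp
  have dp: "((\<lambda>y::real. 1 / y ^ c) has_real_derivative - real c / y ^ Suc c) (at y)" if "y > 0" for y c
  proof -
    have "((\<lambda>y::real. inverse (y ^ c)) has_real_derivative
        - (inverse (y ^ c) * (real c * y ^ (c - Suc 0)) * inverse (y ^ c))) (at y)"
      using that DERIV_pow[of c y] by (intro DERIV_inverse') auto
    also have "- (inverse (y ^ c) * (real c * y ^ (c - Suc 0)) * inverse (y ^ c)) = - real c / y ^ Suc c"
      using that by (cases c) (auto simp: divide_simps)
    finally show ?thesis by (simp add: inverse_eq_divide)
  qed
  have "((\<lambda>x. 1 / ln x ^ b) has_real_derivative (- real b / ln x ^ Suc b) * (1 / x)) (at x)"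
    by (rule DERIV_chain2[where f = "\<lambda>y. 1 / y ^ b" and g = ln, OF dp[OF ln] DERIV_ln_divide])
       (use assms in simp)
  from DERIV_mult[OF dp[of x a] this] show ?thesis
    by (rule DERIV_cong) (use assms in \<open>simp_all add: distrib_left mult_ac\<close>)
qed

lemma recip_power_log_deriv_0:
  assumes "q \<ge> 1"
  shows "recip_power_log_deriv p q 0 x = 1 / (x ^ q * ln x ^ p)"
  using assms by (simp add: recip_power_log_deriv_def recip_power_log_coeff_def recip_sum_0)

text \<open>Matches one term of a differentiated sum with the form that \<open>recip_power_log_has_derivative\<close>
  gives it.\<close>

lemma mult_derivative_factor:
  "A * (- (1 / X) * (a / L + b / L')) = - (1 / X) * (a * A / L + b * A / (L'::real))"
proof -
  have "a * A / L + b * A / L' = A * (a / L + b / L')" by (simp add: distrib_left mult.commute)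
  then show ?thesis by (simp only: mult.left_commute)
qed

text \<open>Differentiation sends the coefficient of \<open>1 / (ln x)^(p + r)\<close> to the exponents \<open>p + r\<close> and
  \<open>p + r + 1\<close>, with factors \<open>q + j\<close> and \<open>p + r\<close>; this is the recurrence of
  \<open>recip_power_log_coeff_Suc_Suc\<close>.\<close>

lemma recip_power_log_deriv_has_derivative:
  fixes x :: real
  assumes "x > 1" "p \<ge> 1" "q \<ge> 1"
  shows "(recip_power_log_deriv p q j has_real_derivative recip_power_log_deriv p q (Suc j) x) (at x)"
proof -
  let ?A = "recip_power_log_coeff p q"
  have eq: "recip_power_log_deriv p q j =
      (\<lambda>x. (- 1) ^ j * (\<Sum>r\<le>j. ?A j r * (1 / x ^ (q + j) * (1 / ln x ^ (p + r)))))"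
    by (auto simp: recip_power_log_deriv_def fun_eq_iff sum_distrib_left)
  have "(recip_power_log_deriv p q j has_real_derivative
      (- 1) ^ j * (\<Sum>r\<le>j. ?A j r * (- (1 / x ^ Suc (q + j)) *
        (real (q + j) / ln x ^ (p + r) + real (p + r) / ln x ^ Suc (p + r))))) (at x)"
    unfolding eq
    by (intro DERIV_cmult DERIV_sum recip_power_log_has_derivative assms)
  also have "(\<Sum>r\<le>j. ?A j r * (- (1 / x ^ Suc (q + j)) *
        (real (q + j) / ln x ^ (p + r) + real (p + r) / ln x ^ Suc (p + r)))) =
      - (1 / x ^ Suc (q + j)) * ((\<Sum>r\<le>j. real (q + j) * ?A j r / ln x ^ (p + r)) +
         (\<Sum>r\<le>j. real (p + r) * ?A j r / ln x ^ Suc (p + r)))"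
    unfolding mult_derivative_factor sum.distrib[symmetric] sum_distrib_left by simp
  \<comment> \<open>The first sum may run to \<open>Suc j\<close> because \<open>{q..q + j - 1}\<close> has only \<open>j\<close> elements.\<close>
  also have "(\<Sum>r\<le>j. real (q + j) * ?A j r / ln x ^ (p + r)) +
         (\<Sum>r\<le>j. real (p + r) * ?A j r / ln x ^ Suc (p + r)) =
       (\<Sum>r\<le>Suc j. ?A (Suc j) r / ln x ^ (p + r))"
  proof -
    have "card {q..q + j - 1} < Suc j" using assms by simp
    from recip_sum_eq_0[OF this] have "?A j (Suc j) = 0" by (simp add: recip_power_log_coeff_def)
    then have "(\<Sum>r\<le>j. real (q + j) * ?A j r / ln x ^ (p + r)) =
        (\<Sum>r\<le>Suc j. real (q + j) * ?A j r / ln x ^ (p + r))" by simp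
    also have "\<dots> = real (q + j) * ?A j 0 / ln x ^ p +
         (\<Sum>r\<le>j. real (q + j) * ?A j (Suc r) / ln x ^ (p + Suc r))"
      by (subst sum.atMost_Suc_shift) simp
    finally show ?thesis
      using assms by (subst sum.atMost_Suc_shift)
        (simp add: recip_power_log_coeff_Suc_0 recip_power_log_coeff_Suc_Suc add_divide_distrib sum.distrib)
  qed
  finally show ?thesis by (simp add: recip_power_log_deriv_def[of p q "Suc j"])
qed

text \<open>The bound \<open>x \<ge> 3\<close> ensures \<open>ln x \<ge> 1\<close> since \<open>e \<le> 3\<close>, so that the powers of \<open>1 / ln x\<close> can be dropped.\<close>

lemma recip_power_log_deriv_bound:
  fixes x :: real
  assumes "x \<ge> 3"
  shows "\<bar>recip_power_log_deriv p q j x\<bar> \<le> (\<Sum>r\<le>j. \<bar>recip_power_log_coeff p q j r\<bar>) / x ^ (q + j)"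
proof -
  have "exp 1 \<le> x" using assms exp_le by linarith
  then have ln: "ln x \<ge> 1" using assms by (simp add: ln_ge_iff)
  have "\<bar>\<Sum>r\<le>j. recip_power_log_coeff p q j r / ln x ^ (p + r)\<bar> \<le> (\<Sum>r\<le>j. \<bar>recip_power_log_coeff p q j r\<bar>)"
  proof (rule order_trans[OF sum_abs], rule sum_mono)
    fix r
    have "\<bar>recip_power_log_coeff p q j r\<bar> / ln x ^ (p + r) \<le> \<bar>recip_power_log_coeff p q j r\<bar> / 1"
      using ln by (intro divide_left_mono one_le_power) auto
    then show "\<bar>recip_power_log_coeff p q j r / ln x ^ (p + r)\<bar> \<le> \<bar>recip_power_log_coeff p q j r\<bar>"
      using ln by (simp add: abs_divide)
  qed
  then show ?thesis
    using assms by (simp add: recip_power_log_deriv_def abs_mult abs_divide power_abs divide_right_mono)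
qed

section \<open>A primitive of the summand\<close>

definition recip_power_log_primitive :: "nat \<Rightarrow> nat \<Rightarrow> real \<Rightarrow> real" where
  "recip_power_log_primitive p q x =
     (1 - real q) ^ (p - 1) / fact (p - 1) * Ei ((1 - real q) * ln x)
     - 1 / x ^ (q - 1) * (\<Sum>r = 1..p - 1. coeff_c p q r / ln x ^ r)"

text \<open>Each \<open>x^(1 - q) / (ln x)^r\<close> contributes to the exponents \<open>r\<close> and \<open>r + 1\<close> of \<open>1 / ln x\<close>. The
  coefficients \<open>c r\<close> are such that \<open>(1 - q) * c (r + 1) = r * c r\<close>, so the contributions telescope:
  the lowest one cancels the derivative of the \<open>Ei\<close> term and the highest one is
  \<open>1 / (x^q * (ln x)^p)\<close>.\<close>

lemma recip_power_log_primitive_has_derivative: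
  fixes x :: real
  assumes x: "x > 1" and p: "p \<ge> 1" and q: "q \<ge> 2"
  shows "(recip_power_log_primitive p q has_real_derivative 1 / (x ^ q * ln x ^ p)) (at x)"
proof -
  obtain u where u: "p = Suc u" using p by (cases p) auto
  define c where "c = coeff_c p q"
  define w where "w = 1 - real q"
  have ln: "ln x > 0" using x by simp
  have qq: "q = Suc (q - 1)" and rq: "real (q - 1) = - w" using q by (auto simp: w_def of_nat_diff)
  have w: "w < 0" using q by (simp add: w_def)
  have expw: "exp (w * ln x) = 1 / x ^ (q - 1)"
  proof -
    have "exp (w * ln x) = inverse (exp (real (q - 1) * ln x))" unfolding rq by (simp add: exp_minus)
    also have "exp (real (q - 1) * ln x) = x ^ (q - 1)"
      using x by (simp only: exp_of_nat_mult exp_ln)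
    finally show ?thesis by (simp add: inverse_eq_divide)
  qed
  have xq: "x ^ q = x ^ (q - 1) * x" by (subst qq) simp
  have E: "((\<lambda>x. Ei (w * ln x)) has_real_derivative 1 / x ^ q * (1 / ln x)) (at x)"
  proof -
    have "w * ln x < 0" using w ln by (simp add: mult_neg_pos)
    moreover have "((\<lambda>x. w * ln x) has_real_derivative w / x) (at x)"
      using x by (auto intro!: derivative_eq_intros)
    ultimately have "((\<lambda>x. Ei (w * ln x)) has_real_derivative
        exp (w * ln x) / (w * ln x) * (w / x)) (at x)"
      by (intro DERIV_chain2[where f = Ei] Ei_has_real_derivative_neg)
    also have "exp (w * ln x) / (w * ln x) * (w / x) = 1 / x ^ q * (1 / ln x)"
      unfolding expw xq using w ln x by (simp add: field_simps)
    finally show ?thesis .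
  qed
  have prim: "recip_power_log_primitive p q = (\<lambda>x. w ^ u / fact u * Ei (w * ln x)
     - (\<Sum>r = 1..u. c r * (1 / x ^ (q - 1) * (1 / ln x ^ r))))"
    by (auto simp: recip_power_log_primitive_def fun_eq_iff u c_def w_def sum_distrib_left)
  have "(recip_power_log_primitive p q has_real_derivative
     w ^ u / fact u * (1 / x ^ q * (1 / ln x)) -
     (\<Sum>r = 1..u. c r * (- (1 / x ^ Suc (q - 1)) *
        (real (q - 1) / ln x ^ r + real r / ln x ^ Suc r)))) (at x)"
    unfolding prim by (intro DERIV_diff DERIV_cmult DERIV_sum recip_power_log_has_derivative E x)
  also have "w ^ u / fact u * (1 / x ^ q * (1 / ln x)) -
     (\<Sum>r = 1..u. c r * (- (1 / x ^ Suc (q - 1)) *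
        (real (q - 1) / ln x ^ r + real r / ln x ^ Suc r))) =
     1 / x ^ q * (w ^ u / fact u / ln x +
       (\<Sum>r = 1..u. real r * c r / ln x ^ Suc r - w * c r / ln x ^ r))"
  proof -
    have factor: "c r * (- (1 / x ^ q) * (- w / ln x ^ r + real r / ln x ^ Suc r)) =
        - (1 / x ^ q * (real r * c r / ln x ^ Suc r - w * c r / ln x ^ r))" for r
      unfolding mult_derivative_factor by simp
    show ?thesis
      unfolding qq[symmetric] rq factor
      unfolding sum_negf sum_distrib_left[symmetric] distrib_left by simp
  qed
  also have "(\<Sum>r = 1..u. real r * c r / ln x ^ Suc r - w * c r / ln x ^ r) =
     (\<Sum>r = 1..u. w ^ (u - r) * fact r / fact u / ln x ^ Suc r
       - w ^ (u - (r - 1)) * fact (r - 1) / fact u / ln x ^ Suc (r - 1))"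
  proof (rule sum.cong[OF refl])
    fix r assume r: "r \<in> {1..u}"
    then have "w * w ^ (u - r) = w ^ (u - (r - 1))" by (simp add: Suc_diff_le flip: power_Suc)
    moreover have "real r * fact (r - 1) = fact r" using r fact_reduce[of r, where 'a = real] by simp
    ultimately have "real r * c r = w ^ (u - r) * fact r / fact u"
      "w * c r = w ^ (u - (r - 1)) * fact (r - 1) / fact u"
      by (simp_all add: c_def coeff_c_def u flip: w_def)
    moreover have "Suc (r - 1) = r" using r by simp
    ultimately show "real r * c r / ln x ^ Suc r - w * c r / ln x ^ r =
      w ^ (u - r) * fact r / fact u / ln x ^ Suc r
       - w ^ (u - (r - 1)) * fact (r - 1) / fact u / ln x ^ Suc (r - 1)"
      by (simp only:)
  qed
  also have "\<dots> = 1 / ln x ^ Suc u - w ^ u / fact u / ln x"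
    unfolding One_nat_def
    by (subst sum_telescope''[of 0 u "\<lambda>r. w ^ (u - r) * fact r / fact u / ln x ^ Suc r", unfolded One_nat_def]) simp_all
  finally show ?thesis by (simp add: u)
qed

section \<open>The asymptotic expansion\<close>

theorem lemma7p3:
  fixes p q :: nat
  assumes "p \<ge> 1" and "q \<ge> 2"
  shows "\<exists>C::real. \<forall>m::nat. m \<ge> 1 \<longrightarrow>
    (\<lambda>n::nat.
        (\<Sum>k = 2..n - 1. 1 / (real k ^ q * ln (real k) ^ p))
        - (C
           + (1 - real q) ^ (p - 1) / fact (p - 1) * Ei ((1 - real q) * ln (real n))
           - 1 / real n ^ (q - 1) * (\<Sum>r = 1..p - 1. coeff_c p q r / ln (real n) ^ r)
           - 1 / 2 * (1 / (real n ^ q * ln (real n) ^ p))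
           - (\<Sum>k = 1..m. (\<Sum>r = 0..2 * k - 1. coeff_d p q r k / ln (real n) ^ (r + p))
                * (1 / real n ^ (2 * k - 1 + q)))))
    \<in> O(\<lambda>n. 1 / real n ^ (2 * m + q))"
proof -
  define g where
    "g = case_nat (recip_power_log_primitive p q) (recip_power_log_deriv p q)"
  have q1: "q \<ge> 1" using assms by simp
  have g1: "g 1 x = 1 / (x ^ q * ln x ^ p)" for x
    using q1 by (simp add: g_def recip_power_log_deriv_0)
  have "\<exists>C. \<forall>N\<ge>1. (\<lambda>n. (\<Sum>k=2..n-1. g 1 (real k)) - (C + (\<Sum>i\<le>N. bernoulli_weight i * g i (real n))))
            \<in> O(\<lambda>n. 1 / real n ^ (q + N - 1))"
  proof (rule euler_maclaurin_asymptotic[where ?n0.0 = 3])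
    fix i and x :: real assume "x \<ge> real 3"
    then show "(g i has_real_derivative g (Suc i) x) (at x)"
      using assms q1 recip_power_log_primitive_has_derivative[of x p q]
        recip_power_log_deriv_has_derivative[of x p q]
      by (cases i) (auto simp: g_def recip_power_log_deriv_0)
  next
    fix j and x :: real assume "x \<ge> real 3"
    then show "\<bar>g (Suc j) x\<bar> \<le> (\<Sum>r\<le>j. \<bar>recip_power_log_coeff p q j r\<bar>) / x ^ (q + j)"
      using recip_power_log_deriv_bound by (simp add: g_def)
  qed (use q1 in auto)
  then obtain C where C: "\<And>N. N \<ge> 1 \<Longrightarrow>
      (\<lambda>n. (\<Sum>k=2..n-1. g 1 (real k)) - (C + (\<Sum>i\<le>N. bernoulli_weight i * g i (real n))))
            \<in> O(\<lambda>n. 1 / real n ^ (q + N - 1))" by blast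
  \<comment> \<open>The derivative in \<open>g (2 * k)\<close> has odd order \<open>2 * k - 1\<close>, whence the minus sign.\<close>
  have term_eq: "bernoulli_weight (2 * k) * g (2 * k) x =
      - ((\<Sum>r = 0..2 * k - 1. coeff_d p q r k / ln x ^ (r + p)) * (1 / x ^ (2 * k - 1 + q)))"
    if k: "k \<ge> 1" for k x
  proof -
    obtain j where j: "2 * k = Suc j" "2 * k - 1 = j" "odd j" using k by (cases k) auto
    have "2 * k + q - 2 = q + j - 1" using j by simp
    then have d: "coeff_d p q r k = bernoulli_weight (2 * k) * recip_power_log_coeff p q j r" for r
      by (simp add: coeff_d_def bernoulli_weight_def recip_power_log_coeff_def)
    have "g (2 * k) x = - (1 / x ^ (j + q)) *
       (\<Sum>r=0..j. recip_power_log_coeff p q j r / ln x ^ (r + p))"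
      using j by (simp add: g_def recip_power_log_deriv_def add.commute atMost_atLeast0)
    moreover have "(\<Sum>r=0..j. bernoulli_weight (2 * k) * recip_power_log_coeff p q j r / ln x ^ (r + p)) =
       bernoulli_weight (2 * k) * (\<Sum>r=0..j. recip_power_log_coeff p q j r / ln x ^ (r + p))"
      by (simp add: sum_distrib_left)
    ultimately show ?thesis unfolding d j(2) by simp
  qed
  have expansion: "(\<Sum>i\<le>2*m+1. bernoulli_weight i * g i x) =
      (1 - real q) ^ (p - 1) / fact (p - 1) * Ei ((1 - real q) * ln x)
           - 1 / x ^ (q - 1) * (\<Sum>r = 1..p - 1. coeff_c p q r / ln x ^ r)
           - 1 / 2 * (1 / (x ^ q * ln x ^ p))
           - (\<Sum>k = 1..m. (\<Sum>r = 0..2 * k - 1. coeff_d p q r k / ln x ^ (r + p))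
                * (1 / x ^ (2 * k - 1 + q)))" for m x
  proof -
    have "(\<Sum>k = 1..m. bernoulli_weight (2 * k) * g (2 * k) x) =
        - (\<Sum>k = 1..m. (\<Sum>r = 0..2 * k - 1. coeff_d p q r k / ln x ^ (r + p))
                * (1 / x ^ (2 * k - 1 + q)))"
      unfolding sum_negf[symmetric] by (rule sum.cong[OF refl], rule term_eq) simp
    moreover have "g 0 x = recip_power_log_primitive p q x" by (simp add: g_def)
    ultimately show ?thesis
      unfolding sum_bernoulli_weight_even g1 recip_power_log_primitive_def by simp
  qed
  show ?thesis
  proof (intro exI allI impI)
    fix m :: nat
    \<comment> \<open>The choice \<open>N = 2 * m + 1\<close> adds no term to \<open>N = 2 * m\<close> but improves the error by one power.\<close>
    have "q + (2 * m + 1) - 1 = 2 * m + q" by simp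
    with C[of "2 * m + 1"] show "(\<lambda>n::nat.
        (\<Sum>k = 2..n - 1. 1 / (real k ^ q * ln (real k) ^ p))
        - (C
           + (1 - real q) ^ (p - 1) / fact (p - 1) * Ei ((1 - real q) * ln (real n))
           - 1 / real n ^ (q - 1) * (\<Sum>r = 1..p - 1. coeff_c p q r / ln (real n) ^ r)
           - 1 / 2 * (1 / (real n ^ q * ln (real n) ^ p))
           - (\<Sum>k = 1..m. (\<Sum>r = 0..2 * k - 1. coeff_d p q r k / ln (real n) ^ (r + p))
                * (1 / real n ^ (2 * k - 1 + q)))))
    \<in> O(\<lambda>n. 1 / real n ^ (2 * m + q))"
      unfolding expansion g1 by (simp only: le_add2 add_diff_eq)
  qed
qed

end
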